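(* Let $\phi(x,y)$ be an $L$-formula, $M$ an $L$-structure, $A$ a set of $l(x)$-tuples from $M$, and $M^{*}$ an $|M|^{+}$-saturated elementary extension of $M$. Suppose that $\phi(x,y)$ has $NIP$ in $A$, where $A$ has cardinality at most $\kappa$. Then the cardinality of the set of $p(x)\in S_{\phi}(M^{*})$ such that $p$ is finitely satisfiable in $A$ is at most $2^{\kappa}$.
   Context: Here $x,y$ are finite tuples of variables, $l(x)$ is the length of $x$, and "$b\in M^*$" means that $b$ is a tuple from $M^*$ of the appropriate length, here $l(y)$. A set $\{a_{\alpha}:\alpha<\lambda\}$ of $l(x)$-tuples from $M$ is an $IP$-witness for $\phi(x,y)$ if for all finite disjoint subsets $I,J$ of $\lambda$, $M\models \exists y(\bigwedge_{\alpha\in I}\phi(a_{\alpha},y)\wedge\bigwedge_{\beta\in J}\neg\phi(a_{\beta},y))$. The formula $\phi(x,y)$ has $IP$ in $A$ if there is a countably infinite sequence $(a_{i}:i<\omega)$ of elements of $A$ which is an $IP$-witness for $\phi(x,y)$; $\phi(x,y)$ has $NIP$ in $A$ if it does not have $IP$ in $A$. $S_{\phi}(M^{*})$ is the space of complete $\phi$-types over $M^*$, i.e. ultrafilters on the Boolean algebra of formulas (definable sets) generated by the $\phi(x,b)$ for $b\in M^{*}$. A type $p(x)\in S_{\phi}(M^{*})$ is finitely satisfiable in $A$ if whenever $\chi(x)\in p$ there is $a\in A$ with $M^{*}\models\chi(a)$. *)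

theory Defs
  imports "HOL-Analysis.Sigma_Algebra" "HOL-Library.NList"
begin

unbundle cardinal_syntax

section \<open>First-order logic\<close>

text \<open>Constants are function symbols of arity 0. The sets of symbols, unlike the types
  \<open>'f\<close> and \<open>'r\<close>, may be empty.\<close>

record ('f, 'r) lang =
  fun_syms :: "'f set"
  fun_arity :: "'f \<Rightarrow> nat"
  rel_syms :: "'r set"
  rel_arity :: "'r \<Rightarrow> nat"

datatype 'f fo_term = Var nat | Fun 'f "'f fo_term list"

datatype ('f, 'r) fo_form =
    Eq "'f fo_term" "'f fo_term"
  | Rel 'r "'f fo_term list"
  | Neg "('f, 'r) fo_form"
  | Conj "('f, 'r) fo_form" "('f, 'r) fo_form"
  | Exists nat "('f, 'r) fo_form"

primrec wf_term :: "('f, 'r) lang \<Rightarrow> 'f fo_term \<Rightarrow> bool" where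
  "wf_term L (Var v) \<longleftrightarrow> True"
| "wf_term L (Fun f ts) \<longleftrightarrow>
     f \<in> fun_syms L \<and> length ts = fun_arity L f \<and> list_all (wf_term L) ts"

primrec wf_form :: "('f, 'r) lang \<Rightarrow> ('f, 'r) fo_form \<Rightarrow> bool" where
  "wf_form L (Eq s t) \<longleftrightarrow> wf_term L s \<and> wf_term L t"
| "wf_form L (Rel r ts) \<longleftrightarrow>
     r \<in> rel_syms L \<and> length ts = rel_arity L r \<and> list_all (wf_term L) ts"
| "wf_form L (Neg \<psi>) \<longleftrightarrow> wf_form L \<psi>"
| "wf_form L (Conj \<psi> \<chi>) \<longleftrightarrow> wf_form L \<psi> \<and> wf_form L \<chi>"
| "wf_form L (Exists v \<psi>) \<longleftrightarrow> wf_form L \<psi>"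

primrec term_vars :: "'f fo_term \<Rightarrow> nat set" where
  "term_vars (Var v) = {v}"
| "term_vars (Fun f ts) = \<Union> (set (map term_vars ts))"

primrec free_vars :: "('f, 'r) fo_form \<Rightarrow> nat set" where
  "free_vars (Eq s t) = term_vars s \<union> term_vars t"
| "free_vars (Rel r ts) = \<Union> (set (map term_vars ts))"
| "free_vars (Neg \<psi>) = free_vars \<psi>"
| "free_vars (Conj \<psi> \<chi>) = free_vars \<psi> \<union> free_vars \<chi>"
| "free_vars (Exists v \<psi>) = free_vars \<psi> - {v}"

record ('f, 'r, 'm) fo_struct =
  univ :: "'m set"
  fun_int :: "'f \<Rightarrow> 'm list \<Rightarrow> 'm"
  rel_int :: "'r \<Rightarrow> 'm list \<Rightarrow> bool"

definition is_struct :: "('f, 'r) lang \<Rightarrow> ('f, 'r, 'm) fo_struct \<Rightarrow> bool" where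
  "is_struct L M \<longleftrightarrow>
     univ M \<noteq> {} \<and>
     (\<forall>f \<in> fun_syms L. \<forall>as \<in> nlists (fun_arity L f) (univ M). fun_int M f as \<in> univ M)"

primrec term_val :: "('f, 'r, 'm) fo_struct \<Rightarrow> (nat \<Rightarrow> 'm) \<Rightarrow> 'f fo_term \<Rightarrow> 'm" where
  "term_val M e (Var v) = e v"
| "term_val M e (Fun f ts) = fun_int M f (map (term_val M e) ts)"

primrec sat :: "('f, 'r, 'm) fo_struct \<Rightarrow> (nat \<Rightarrow> 'm) \<Rightarrow> ('f, 'r) fo_form \<Rightarrow> bool" where
  "sat M e (Eq s t) \<longleftrightarrow> term_val M e s = term_val M e t"
| "sat M e (Rel r ts) \<longleftrightarrow> rel_int M r (map (term_val M e) ts)"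
| "sat M e (Neg \<psi>) \<longleftrightarrow> \<not> sat M e \<psi>"
| "sat M e (Conj \<psi> \<chi>) \<longleftrightarrow> sat M e \<psi> \<and> sat M e \<chi>"
| "sat M e (Exists v \<psi>) \<longleftrightarrow> (\<exists>c \<in> univ M. sat M (e(v := c)) \<psi>)"

definition substructure ::
  "('f, 'r) lang \<Rightarrow> ('f, 'r, 'm) fo_struct \<Rightarrow> ('f, 'r, 'm) fo_struct \<Rightarrow> bool" where
  "substructure L M N \<longleftrightarrow>
     is_struct L M \<and> is_struct L N \<and> univ M \<subseteq> univ N \<and>
     (\<forall>f \<in> fun_syms L. \<forall>as \<in> nlists (fun_arity L f) (univ M). fun_int N f as = fun_int M f as) \<and>
     (\<forall>r \<in> rel_syms L. \<forall>as \<in> nlists (rel_arity L r) (univ M). rel_int N r as = rel_int M r as)"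

definition elementary_extension ::
  "('f, 'r) lang \<Rightarrow> ('f, 'r, 'm) fo_struct \<Rightarrow> ('f, 'r, 'm) fo_struct \<Rightarrow> bool" where
  "elementary_extension L M N \<longleftrightarrow>
     substructure L M N \<and>
     (\<forall>\<psi> e. wf_form L \<psi> \<and> e ` free_vars \<psi> \<subseteq> univ M \<longrightarrow> (sat M e \<psi> \<longleftrightarrow> sat N e \<psi>))"

text \<open>A formula with parameters from \<open>B\<close> in the single variable \<open>x\<close> is a pair \<open>(\<psi>, e)\<close>: the
  variable numbered 0 plays the role of \<open>x\<close>, and \<open>e\<close> substitutes elements of \<open>B\<close> for the other
  free variables of \<open>\<psi>\<close>.\<close>

definition formulas_over ::
  "('f, 'r) lang \<Rightarrow> 'm set \<Rightarrow> (('f, 'r) fo_form \<times> (nat \<Rightarrow> 'm)) set" where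
  "formulas_over L B = {(\<psi>, e). wf_form L \<psi> \<and> e ` (free_vars \<psi> - {0}) \<subseteq> B}"

definition realises ::
  "('f, 'r, 'm) fo_struct \<Rightarrow> 'm \<Rightarrow> (('f, 'r) fo_form \<times> (nat \<Rightarrow> 'm)) set \<Rightarrow> bool" where
  "realises N c \<Gamma> \<longleftrightarrow> (\<forall>(\<psi>, e) \<in> \<Gamma>. sat N (e(0 := c)) \<psi>)"

text \<open>Consistency of \<open>\<Gamma>\<close> with the elementary diagram of \<open>N\<close> is expressed as finite
  satisfiability of \<open>\<Gamma>\<close> in \<open>N\<close>.\<close>

definition saturated ::
  "('f, 'r) lang \<Rightarrow> 'k rel \<Rightarrow> ('f, 'r, 'm) fo_struct \<Rightarrow> bool" where
  "saturated L \<mu> N \<longleftrightarrow>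
     (\<forall>B \<Gamma>. B \<subseteq> univ N \<and> |B| <o \<mu> \<and> \<Gamma> \<subseteq> formulas_over L B \<and>
        (\<forall>\<Delta> \<subseteq> \<Gamma>. finite \<Delta> \<longrightarrow> (\<exists>c \<in> univ N. realises N c \<Delta>)) \<longrightarrow>
        (\<exists>c \<in> univ N. realises N c \<Gamma>))"

section \<open>Formulas with two tuples of variables, IP and NIP\<close>

text \<open>The tuples \<open>x\<close> and \<open>y\<close> of a formula \<open>\<phi>(x,y)\<close> are the lists \<open>xs\<close> and \<open>ys\<close> of variables.\<close>

definition is_formula_in ::
  "('f, 'r) lang \<Rightarrow> ('f, 'r) fo_form \<Rightarrow> nat list \<Rightarrow> nat list \<Rightarrow> bool" where
  "is_formula_in L \<phi> xs ys \<longleftrightarrow>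
     wf_form L \<phi> \<and> distinct (xs @ ys) \<and> free_vars \<phi> \<subseteq> set (xs @ ys)"

definition holds ::
  "('f, 'r, 'm) fo_struct \<Rightarrow> ('f, 'r) fo_form \<Rightarrow> nat list \<Rightarrow> nat list \<Rightarrow> 'm list \<Rightarrow> 'm list \<Rightarrow> bool"
where
  "holds M \<phi> xs ys a b \<longleftrightarrow> sat M (\<lambda>v. the (map_of (zip (xs @ ys) (a @ b)) v)) \<phi>"

definition IP_witness ::
  "('f, 'r, 'm) fo_struct \<Rightarrow> ('f, 'r) fo_form \<Rightarrow> nat list \<Rightarrow> nat list \<Rightarrow>
     'i set \<Rightarrow> ('i \<Rightarrow> 'm list) \<Rightarrow> bool" where
  "IP_witness M \<phi> xs ys \<Lambda> a \<longleftrightarrow>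
     (\<forall>I J. finite I \<and> finite J \<and> I \<subseteq> \<Lambda> \<and> J \<subseteq> \<Lambda> \<and> I \<inter> J = {} \<longrightarrow>
        (\<exists>b \<in> nlists (length ys) (univ M).
           (\<forall>\<alpha> \<in> I. holds M \<phi> xs ys (a \<alpha>) b) \<and> (\<forall>\<beta> \<in> J. \<not> holds M \<phi> xs ys (a \<beta>) b)))"

definition IP_in ::
  "('f, 'r, 'm) fo_struct \<Rightarrow> ('f, 'r) fo_form \<Rightarrow> nat list \<Rightarrow> nat list \<Rightarrow> 'm list set \<Rightarrow> bool" where
  "IP_in M \<phi> xs ys A \<longleftrightarrow>
     (\<exists>a :: nat \<Rightarrow> 'm list. range a \<subseteq> A \<and> IP_witness M \<phi> xs ys UNIV a)"

definition NIP_in ::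
  "('f, 'r, 'm) fo_struct \<Rightarrow> ('f, 'r) fo_form \<Rightarrow> nat list \<Rightarrow> nat list \<Rightarrow> 'm list set \<Rightarrow> bool" where
  "NIP_in M \<phi> xs ys A \<longleftrightarrow> \<not> IP_in M \<phi> xs ys A"

section \<open>Complete \<open>\<phi>\<close>-types\<close>

definition phi_set ::
  "('f, 'r, 'm) fo_struct \<Rightarrow> ('f, 'r) fo_form \<Rightarrow> nat list \<Rightarrow> nat list \<Rightarrow> 'm list \<Rightarrow> 'm list set" where
  "phi_set M \<phi> xs ys b = {a \<in> nlists (length xs) (univ M). holds M \<phi> xs ys a b}"

definition phi_algebra ::
  "('f, 'r, 'm) fo_struct \<Rightarrow> ('f, 'r) fo_form \<Rightarrow> nat list \<Rightarrow> nat list \<Rightarrow> 'm list set set" where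
  "phi_algebra M \<phi> xs ys =
     algebra (nlists (length xs) (univ M)) hull
       (phi_set M \<phi> xs ys ` nlists (length ys) (univ M))"

definition ultrafilter_on :: "'a set \<Rightarrow> 'a set set \<Rightarrow> 'a set set \<Rightarrow> bool" where
  "ultrafilter_on \<Omega> \<B> U \<longleftrightarrow>
     U \<subseteq> \<B> \<and> \<Omega> \<in> U \<and> {} \<notin> U \<and>
     (\<forall>S \<in> U. \<forall>T \<in> U. S \<inter> T \<in> U) \<and>
     (\<forall>S \<in> U. \<forall>T \<in> \<B>. S \<subseteq> T \<longrightarrow> T \<in> U) \<and>
     (\<forall>S \<in> \<B>. S \<in> U \<or> \<Omega> - S \<in> U)"

definition phi_types ::
  "('f, 'r, 'm) fo_struct \<Rightarrow> ('f, 'r) fo_form \<Rightarrow> nat list \<Rightarrow> nat list \<Rightarrow> 'm list set set set" where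
  "phi_types M \<phi> xs ys =
     {p. ultrafilter_on (nlists (length xs) (univ M)) (phi_algebra M \<phi> xs ys) p}"

definition finitely_satisfiable_in :: "'a set set \<Rightarrow> 'a set \<Rightarrow> bool" where
  "finitely_satisfiable_in p A \<longleftrightarrow> (\<forall>S \<in> p. \<exists>a \<in> A. a \<in> S)"

end

theory Submission
  imports "HOL-Algebra.Free_Abelian_Groups" Defs
begin

text \<open>A \<open>\<phi>\<close>-type \<open>p\<close> over \<open>M\<^sup>*\<close> is determined by its trace, the set of parameters \<open>b\<close> with
  \<open>\<phi>(x,b) \<in> p\<close>. If \<open>p\<close> is finitely satisfiable in \<open>A\<close>, then on every finite set of parameters the
  trace agrees with \<open>\<phi>(a,y)\<close> for some \<open>a \<in> A\<close>. So the traces to be counted are pointwise limits of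
  the family \<open>\<phi>(a,y)\<close>, \<open>a \<in> A\<close>, and a priori there could be \<open>2\<close> to the \<open>2\<^sup>\<kappa>\<close> of them.

  The hypothesis NIP enters as in the theorem of Bourgain, Fremlin and Talagrand. Call a set of
  parameters a sign cell if it is given by prescribing the truth values of \<open>\<phi>(a,y)\<close> for finitely many
  \<open>a \<in> A\<close>. Then every nonempty set \<open>C\<close> of parameters meets a sign cell on whose intersection with
  \<open>C\<close> the trace is constant. Otherwise the trace splits each sign cell that meets \<open>C\<close>; as the trace
  is a limit of members of the family, a single \<open>a \<in> A\<close> can split any finite number of cells at
  once, and repeating this gives an infinite independent sequence in \<open>A\<close>
  (\<open>independent_sequence_exists\<close>). This is IP of \<open>\<phi>\<close> in \<open>A\<close> computed in \<open>M\<^sup>*\<close>, and it holds in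
  \<open>M\<close> too, since realisability of a finite pattern of signs is expressed by a first-order formula
  (\<open>IP_in_descends\<close>).

  A set with this property is given by a transfinite decision list: remove from the set of all
  parameters, one after the other, sign cells on which the trace is constant on what is left. Each
  cell is used at most once, so the list is coded by a relation on the set of cells
  (\<open>decision_list_exists\<close>). For infinite \<open>A\<close> there are \<open>|A|\<close> cells, which leaves at most
  \<open>2\<close> to the \<open>|A|\<close> traces. For finite \<open>A\<close> every such type is the type of an element of \<open>A\<close>.\<close>

section \<open>Transfinite decision lists over a family of sets\<close>

text \<open>A function that is constant on a relatively open piece of every nonempty \<open>C \<subseteq> Y\<close> is
  peeled off transfinitely: starting from \<open>Y\<close>, keep removing a piece on which \<open>f\<close> is constant.
  A removed \<open>U i\<close> is disjoint from everything that remains, so no index is used twice, and the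
  process exhausts \<open>Y\<close>. The value \<open>f y\<close> is then read off at the first index whose set contains
  \<open>y\<close>. The relation \<open>R\<close> records this list: off the diagonal it is the order of removal, and
  the diagonal marks the indices at which the value is \<open>True\<close>. That \<open>R\<close> lives on \<open>I\<close>, whatever
  the size of \<open>Y\<close>, is what makes the count possible.\<close>

lemma decision_list_exists:
  fixes U :: "'i \<Rightarrow> 'y set" and f :: "'y \<Rightarrow> bool"
  assumes const: "\<And>C. C \<subseteq> Y \<Longrightarrow> C \<noteq> {} \<Longrightarrow>
      \<exists>i\<in>I. U i \<inter> C \<noteq> {} \<and> (\<exists>v. \<forall>y\<in>U i \<inter> C. f y = v)"
  shows "\<exists>R\<subseteq>I \<times> I. \<forall>y\<in>Y. f y \<longleftrightarrow>
      (\<exists>i. (i, i) \<in> R \<and> y \<in> U i \<and> (\<forall>j. (j, i) \<in> R \<and> y \<in> U j \<longrightarrow> j = i))"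
proof -
  obtain pick where pick: "pick C \<in> I" "U (pick C) \<inter> C \<noteq> {}"
      "\<exists>v. \<forall>y\<in>U (pick C) \<inter> C. f y = v" if "C \<subseteq> Y" "C \<noteq> {}" for C
    using const by metis
  \<comment> \<open>The stages are the elements of a well-ordered set larger than the type of
    indices, so that the stages at which something remains cannot be all of them.\<close>
  obtain r :: "'i set rel" where r: "Well_order r" "Field r = UNIV"
    using well_ordering by metis
  define s where "s = r - Id"
  have lin: "linear_order r" and wf: "wf s"
    using r by (simp_all add: s_def well_order_on_def)
  have total: "(\<beta>, \<gamma>) \<in> s \<or> \<beta> = \<gamma> \<or> (\<gamma>, \<beta>) \<in> s" for \<beta> \<gamma>
    using lin unfolding s_def linear_order_on_def total_on_def by blast
  have "trans s"
    using lin unfolding s_def order_on_defs by (blast intro: trans_diff_Id)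
  then have trans: "(\<beta>, \<delta>) \<in> s" if "(\<beta>, \<gamma>) \<in> s" "(\<gamma>, \<delta>) \<in> s" for \<beta> \<gamma> \<delta>
    using that by (blast dest: transD)
  define G where
    "G = wfrec s (\<lambda>g \<alpha>. pick (Y - (\<Union>\<beta>\<in>{\<beta>. (\<beta>, \<alpha>) \<in> s}. U (g \<beta>))))"
  \<comment> \<open>\<open>G \<alpha>\<close> is the index removed at stage \<open>\<alpha>\<close>, and \<open>C \<alpha>\<close> is what remains before it.\<close>
  define C where "C \<alpha> = Y - (\<Union>\<beta>\<in>{\<beta>. (\<beta>, \<alpha>) \<in> s}. U (G \<beta>))" for \<alpha>
  have G: "G \<alpha> = pick (C \<alpha>)" for \<alpha>
  proof -
    have "G \<alpha> = pick (Y - (\<Union>\<beta>\<in>{\<beta>. (\<beta>, \<alpha>) \<in> s}. U (cut G s \<alpha> \<beta>)))"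
      unfolding G_def by (subst wfrec[OF wf]) simp
    then show ?thesis
      by (simp add: C_def cut_apply)
  qed
  have C_sub: "C \<alpha> \<subseteq> Y" for \<alpha>
    by (auto simp: C_def)
  have G_neq: "G \<beta> \<noteq> G \<gamma>" if "(\<beta>, \<gamma>) \<in> s" "C \<gamma> \<noteq> {}" for \<beta> \<gamma>
  proof -
    have "U (G \<gamma>) \<inter> C \<gamma> \<noteq> {}"
      using pick(2)[OF C_sub that(2)] by (simp add: G)
    moreover have "U (G \<beta>) \<inter> C \<gamma> = {}"
      using that(1) by (auto simp: C_def)
    ultimately show ?thesis by auto
  qed
  have "\<exists>\<alpha>. C \<alpha> = {}"
  proof (rule ccontr)
    assume "\<nexists>\<alpha>. C \<alpha> = {}"
    then have "inj G"
      using G_neq total by (metis injI)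
    then have "|UNIV :: 'i set set| \<le>o |UNIV :: 'i set|"
      by (intro card_of_ordLeqI[of G]) auto
    then show False
      using card_of_set_type not_ordLess_ordLeq by blast
  qed
  \<comment> \<open>The list ends at the first stage \<open>\<alpha>\<close> at which nothing remains; only earlier stages
    pick a meaningful index.\<close>
  have minimal: "\<exists>\<alpha>. P \<alpha> \<and> (\<forall>\<beta>. (\<beta>, \<alpha>) \<in> s \<longrightarrow> \<not> P \<beta>)" if "P \<gamma>" for P \<gamma>
    using wf[unfolded wf_eq_minimal, rule_format, of \<gamma> "Collect P"] that by auto
  obtain \<alpha> where \<alpha>: "C \<alpha> = {}" and min: "\<And>\<beta>. (\<beta>, \<alpha>) \<in> s \<Longrightarrow> C \<beta> \<noteq> {}"
    using \<open>\<exists>\<alpha>. C \<alpha> = {}\<close> minimal[of "\<lambda>\<alpha>. C \<alpha> = {}"] by metis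
  define R where "R = {(G \<beta>, G \<gamma>) | \<beta> \<gamma>. (\<beta>, \<gamma>) \<in> s \<and> (\<gamma>, \<alpha>) \<in> s} \<union>
      {(G \<beta>, G \<beta>) | \<beta>. (\<beta>, \<alpha>) \<in> s \<and> (\<forall>y\<in>U (G \<beta>) \<inter> C \<beta>. f y)}"
  have G_inj: "\<beta> = \<gamma>" if "G \<beta> = G \<gamma>" "(\<beta>, \<alpha>) \<in> s" "(\<gamma>, \<alpha>) \<in> s" for \<beta> \<gamma>
    using that G_neq min total by metis
  have G_mem: "G \<beta> \<in> I" if "(\<beta>, \<alpha>) \<in> s" for \<beta>
    using pick(1)[OF C_sub min[OF that]] by (simp add: G)
  have "R \<subseteq> I \<times> I"
    using G_mem trans unfolding R_def by blast
  moreover have "f y \<longleftrightarrow>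
      (\<exists>i. (i, i) \<in> R \<and> y \<in> U i \<and> (\<forall>j. (j, i) \<in> R \<and> y \<in> U j \<longrightarrow> j = i))"
    if "y \<in> Y" for y
  proof -
    obtain \<beta> where "(\<beta>, \<alpha>) \<in> s \<and> y \<in> U (G \<beta>)"
      using \<alpha> \<open>y \<in> Y\<close> by (auto simp: C_def)
    from minimal[of "\<lambda>\<beta>. (\<beta>, \<alpha>) \<in> s \<and> y \<in> U (G \<beta>)", OF this]
    obtain \<mu> where \<mu>: "(\<mu>, \<alpha>) \<in> s" "y \<in> U (G \<mu>)"
      and \<mu>_min: "\<And>\<beta>. (\<beta>, \<mu>) \<in> s \<Longrightarrow> y \<notin> U (G \<beta>)"
      using trans by metis
    \<comment> \<open>\<open>\<mu>\<close> is the stage at which \<open>y\<close> is removed.\<close>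
    have y: "y \<in> U (G \<mu>) \<inter> C \<mu>"
      using \<mu> \<mu>_min \<open>y \<in> Y\<close> by (auto simp: C_def)
    show ?thesis
    proof
      assume "f y"
      then have "\<forall>z\<in>U (G \<mu>) \<inter> C \<mu>. f z"
        using pick(3)[OF C_sub min[OF \<mu>(1)]] y unfolding G by metis
      then have "(G \<mu>, G \<mu>) \<in> R"
        using \<mu>(1) unfolding R_def by blast
      moreover have "j = G \<mu>" if j: "(j, G \<mu>) \<in> R" "y \<in> U j" for j
      proof (rule ccontr)
        assume "j \<noteq> G \<mu>"
        then obtain \<beta> \<gamma> where "j = G \<beta>" "G \<mu> = G \<gamma>" "(\<beta>, \<gamma>) \<in> s" "(\<gamma>, \<alpha>) \<in> s"
          using j(1) unfolding R_def by auto
        then show False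
          using G_inj[of \<mu> \<gamma>] \<mu>(1) \<mu>_min j(2) by blast
      qed
      ultimately show "\<exists>i. (i, i) \<in> R \<and> y \<in> U i \<and> (\<forall>j. (j, i) \<in> R \<and> y \<in> U j \<longrightarrow> j = i)"
        using \<mu>(2) by blast
    next
      assume "\<exists>i. (i, i) \<in> R \<and> y \<in> U i \<and> (\<forall>j. (j, i) \<in> R \<and> y \<in> U j \<longrightarrow> j = i)"
      then obtain i where i: "(i, i) \<in> R" "y \<in> U i"
        and first: "\<And>j. (j, i) \<in> R \<Longrightarrow> y \<in> U j \<Longrightarrow> j = i"
        by blast
      from i(1) obtain \<beta> where \<beta>: "i = G \<beta>" "(\<beta>, \<alpha>) \<in> s" "\<forall>z\<in>U (G \<beta>) \<inter> C \<beta>. f z"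
        unfolding R_def by (auto dest: G_neq[OF _ min])
      consider "\<beta> = \<mu>" | "(\<mu>, \<beta>) \<in> s" | "(\<beta>, \<mu>) \<in> s"
        using total by blast
      then show "f y"
      proof cases
        case 1
        then show ?thesis
          using \<beta>(3) y by blast
      next
        case 2
        then have "(G \<mu>, i) \<in> R"
          using \<beta> unfolding R_def by blast
        then have "G \<mu> = G \<beta>"
          using first \<mu>(2) \<beta>(1) by blast
        then show ?thesis
          using G_neq[OF 2 min[OF \<beta>(2)]] by simp
      next
        case 3
        then show ?thesis
          using \<mu>_min i(2) \<beta>(1) by blast
      qed
    qed
  qed
  ultimately show ?thesis by blast
qed

text \<open>Each member of \<open>\<F>\<close> is decoded from a relation on \<open>I\<close>, and for infinite \<open>I\<close> there are only
  \<open>|Pow I|\<close> of these. When the sets \<open>U i\<close> form a base of a topology, \<open>const\<close> says that the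
  restriction of the indicator function of \<open>D\<close> to any nonempty subspace has a point of continuity.\<close>

lemma card_of_piecewise_constant_sets:
  fixes U :: "'i \<Rightarrow> 'y set"
  assumes inf: "infinite I"
    and sub: "\<And>D. D \<in> \<F> \<Longrightarrow> D \<subseteq> Y"
    and const: "\<And>D C. D \<in> \<F> \<Longrightarrow> C \<subseteq> Y \<Longrightarrow> C \<noteq> {} \<Longrightarrow>
      \<exists>i\<in>I. U i \<inter> C \<noteq> {} \<and> (U i \<inter> C \<subseteq> D \<or> U i \<inter> C \<inter> D = {})"
  shows "|\<F>| \<le>o |Pow I|"
proof -
  define decode where "decode R = {y \<in> Y.
      \<exists>i. (i, i) \<in> R \<and> y \<in> U i \<and> (\<forall>j. (j, i) \<in> R \<and> y \<in> U j \<longrightarrow> j = i)}" for R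
  have "\<F> \<subseteq> decode ` Pow (I \<times> I)"
  proof
    fix D assume D: "D \<in> \<F>"
    have "\<exists>i\<in>I. U i \<inter> C \<noteq> {} \<and> (\<exists>v. \<forall>y\<in>U i \<inter> C. (y \<in> D) = v)"
      if "C \<subseteq> Y" "C \<noteq> {}" for C
      using const[OF D that] by blast
    from decision_list_exists[of Y I U "\<lambda>y. y \<in> D", OF this]
    obtain R where "R \<subseteq> I \<times> I" "\<forall>y\<in>Y. y \<in> D \<longleftrightarrow>
        (\<exists>i. (i, i) \<in> R \<and> y \<in> U i \<and> (\<forall>j. (j, i) \<in> R \<and> y \<in> U j \<longrightarrow> j = i))"
      by blast
    then have "D = decode R" "R \<in> Pow (I \<times> I)"
      using sub[OF D] unfolding decode_def by blast+
    then show "D \<in> decode ` Pow (I \<times> I)" by blast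
  qed
  then have "|\<F>| \<le>o |Pow (I \<times> I)|"
    by (rule surj_imp_ordLeq)
  moreover have "|Pow (I \<times> I)| \<le>o |Pow I|"
    using card_of_Times_same_infinite[OF inf] ordIso_iff_ordLeq card_of_Pow_mono by blast
  ultimately show ?thesis
    by (rule ordLeq_transitive)
qed

section \<open>Independent sequences\<close>

text \<open>For a pair of finite sets these are the basic open sets of the coarsest topology in which all
  \<open>rel a\<close> are continuous.\<close>

definition sign_cell :: "('a \<Rightarrow> 'y \<Rightarrow> bool) \<Rightarrow> 'a set \<times> 'a set \<Rightarrow> 'y set" where
  "sign_cell rel PN = {y. (\<forall>a\<in>fst PN. rel a y) \<and> (\<forall>a\<in>snd PN. \<not> rel a y)}"

text \<open>On \<open>C\<close>, the set \<open>D\<close> is a pointwise limit of the sets \<open>{y. rel a y}\<close> with \<open>a \<in> A\<close>, by \<open>sep\<close>,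
  and it splits every sign cell that meets \<open>C\<close>, by \<open>mixed\<close>. Given a finite shattered \<open>S\<close>, each of the finitely
  many cells of \<open>S\<close> contains a point of \<open>C \<inter> D\<close> and a point of \<open>C - D\<close>; one \<open>a \<in> A\<close> agrees with
  \<open>D\<close> at all of these points, so it splits every cell and \<open>insert a S\<close> is shattered. Iterating
  gives an independent sequence.\<close>

lemma independent_sequence_exists:
  fixes rel :: "'a \<Rightarrow> 'y \<Rightarrow> bool"
  assumes "C \<noteq> {}"
    and sep: "\<And>P N. finite P \<Longrightarrow> finite N \<Longrightarrow> P \<subseteq> C \<inter> D \<Longrightarrow> N \<subseteq> C - D \<Longrightarrow>
      \<exists>a\<in>A. (\<forall>y\<in>P. rel a y) \<and> (\<forall>y\<in>N. \<not> rel a y)"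
    and mixed: "\<And>i. i \<in> Fpow A \<times> Fpow A \<Longrightarrow> sign_cell rel i \<inter> C \<noteq> {} \<Longrightarrow>
      sign_cell rel i \<inter> C \<inter> D \<noteq> {} \<and> sign_cell rel i \<inter> C - D \<noteq> {}"
  shows "\<exists>s :: nat \<Rightarrow> 'a. range s \<subseteq> A \<and>
    (\<forall>I J. finite I \<and> finite J \<and> I \<inter> J = {} \<longrightarrow>
       (\<exists>y\<in>C. (\<forall>i\<in>I. rel (s i) y) \<and> (\<forall>j\<in>J. \<not> rel (s j) y)))"
proof -
  define shattered where
    "shattered S \<longleftrightarrow> (\<forall>P\<subseteq>S. sign_cell rel (P, S - P) \<inter> C \<noteq> {})" for S
  have step: "\<exists>a\<in>A - S. shattered (insert a S)"
    if S: "S \<in> Fpow A" "shattered S" for S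
  proof -
    have "\<exists>y z. y \<in> sign_cell rel (P, S - P) \<inter> C \<inter> D \<and> z \<in> sign_cell rel (P, S - P) \<inter> C - D"
      if "P \<subseteq> S" for P
    proof -
      have "(P, S - P) \<in> Fpow A \<times> Fpow A"
        using S(1) that by (auto simp: Fpow_def intro: finite_subset)
      from mixed[OF this] show ?thesis
        using S(2) that unfolding shattered_def by blast
    qed
    then obtain y z where y: "\<And>P. P \<subseteq> S \<Longrightarrow> y P \<in> sign_cell rel (P, S - P) \<inter> C \<inter> D"
      and z: "\<And>P. P \<subseteq> S \<Longrightarrow> z P \<in> sign_cell rel (P, S - P) \<inter> C - D"
      by metis
    have "finite (Pow S)"
      using S(1) by (simp add: Fpow_def)
    then obtain a where a: "a \<in> A" "\<And>P. P \<subseteq> S \<Longrightarrow> rel a (y P)" "\<And>P. P \<subseteq> S \<Longrightarrow> \<not> rel a (z P)"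
    proof -
      have "\<exists>a\<in>A. (\<forall>u\<in>y ` Pow S. rel a u) \<and> (\<forall>u\<in>z ` Pow S. \<not> rel a u)"
        using \<open>finite (Pow S)\<close> y z by (intro sep) blast+
      then show thesis
        using that by blast
    qed
    \<comment> \<open>The points \<open>y {}\<close> and \<open>z {}\<close> lie in the same cell of \<open>S\<close>, but \<open>a\<close> separates them. Freshness
      of \<open>a\<close> makes the resulting sequence injective, which is needed to turn disjoint sets of
      indices into disjoint sets of members of \<open>A\<close>.\<close>
    have "a \<notin> S"
    proof
      assume "a \<in> S"
      then show False
        using a(2)[of "{}"] y[of "{}"] by (auto simp: sign_cell_def)
    qed
    moreover have "sign_cell rel (P, insert a S - P) \<inter> C \<noteq> {}" if P: "P \<subseteq> insert a S" for P
    proof (cases "a \<in> P")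
      case True
      have sub: "P - {a} \<subseteq> S"
        using P by blast
      have "y (P - {a}) \<in> sign_cell rel (P, insert a S - P) \<inter> C"
        using y[OF sub] a(2)[OF sub] True by (auto simp: sign_cell_def)
      then show ?thesis by blast
    next
      case False
      then have sub: "P \<subseteq> S"
        using P by blast
      have "z P \<in> sign_cell rel (P, insert a S - P) \<inter> C"
        using z[OF sub] a(3)[OF sub] by (auto simp: sign_cell_def)
      then show ?thesis by blast
    qed
    ultimately show ?thesis
      using a(1) unfolding shattered_def by blast
  qed
  have "\<exists>S :: nat \<Rightarrow> 'a set. \<forall>n. (S n \<in> Fpow A \<and> shattered (S n)) \<and>
      (\<exists>a\<in>A - S n. S (Suc n) = insert a (S n))"
  proof (rule dependent_nat_choice)
    show "\<exists>S. S \<in> Fpow A \<and> shattered S"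
      using \<open>C \<noteq> {}\<close> by (intro exI[of _ "{}"]) (auto simp: Fpow_def shattered_def sign_cell_def)
  next
    fix S and n :: nat
    assume S: "S \<in> Fpow A \<and> shattered S"
    then obtain a where "a \<in> A - S" "shattered (insert a S)"
      using step by blast
    with S show "\<exists>T. (T \<in> Fpow A \<and> shattered T) \<and> (\<exists>a\<in>A - S. T = insert a S)"
      by (intro exI[of _ "insert a S"]) (auto simp: Fpow_def)
  qed
  then obtain S :: "nat \<Rightarrow> 'a set" and s where S: "\<And>n. shattered (S n)"
    and s: "\<And>n. s n \<in> A - S n" "\<And>n. S (Suc n) = insert (s n) (S n)"
    by metis
  have mem: "s m \<in> S n" if "m < n" for m n
    using that by (induction n) (auto simp: s(2) less_Suc_eq)
  have inj: "inj s"
    using mem s(1) by (intro linorder_injI) (metis DiffD2)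
  have "\<exists>y\<in>C. (\<forall>i\<in>I. rel (s i) y) \<and> (\<forall>j\<in>J. \<not> rel (s j) y)"
    if IJ: "finite I" "finite J" "I \<inter> J = {}" for I J
  proof -
    obtain n where n: "I \<union> J \<subseteq> {..<n}"
      using IJ finite_nat_bounded by blast
    have "s ` I \<subseteq> S n"
      using n mem by auto
    then obtain y where "y \<in> C" "y \<in> sign_cell rel (s ` I, S n - s ` I)"
      using S[of n] unfolding shattered_def by blast
    moreover have "s ` J \<subseteq> S n - s ` I"
      using n mem inj IJ(3) by (auto dest: injD)
    ultimately show ?thesis
      by (intro bexI[of _ y]) (auto simp: sign_cell_def)
  qed
  then show ?thesis
    using s(1) by blast
qed

section \<open>Sign patterns in an elementary extension\<close>

lemma term_val_cong:
  "(\<And>v. v \<in> term_vars t \<Longrightarrow> e v = e' v) \<Longrightarrow> term_val M e t = term_val M e' t"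
proof (induction t)
  case (Fun f ts)
  then have "map (term_val M e) ts = map (term_val M e') ts"
    by (intro map_cong) auto
  then show ?case
    by (simp only: term_val.simps)
qed simp

lemma sat_cong:
  "(\<And>v. v \<in> free_vars \<psi> \<Longrightarrow> e v = e' v) \<Longrightarrow> sat M e \<psi> \<longleftrightarrow> sat M e' \<psi>"
proof (induction \<psi> arbitrary: e e')
  case (Eq s t)
  then show ?case
    using term_val_cong[of s e e' M] term_val_cong[of t e e' M] by simp
next
  case (Rel r ts)
  then have "map (term_val M e) ts = map (term_val M e') ts"
    by (intro map_cong refl term_val_cong) auto
  then show ?case
    by (simp only: sat.simps)
next
  case (Conj \<psi> \<chi>)
  have "sat M e \<psi> \<longleftrightarrow> sat M e' \<psi>" "sat M e \<chi> \<longleftrightarrow> sat M e' \<chi>"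
    by (rule Conj.IH; use Conj.prems in simp)+
  then show ?case by simp
next
  case (Exists v \<psi>)
  have "sat M (e(v := c)) \<psi> \<longleftrightarrow> sat M (e'(v := c)) \<psi>" for c
    by (rule Exists.IH) (use Exists.prems in simp)
  then show ?case by simp
next
  case (Neg \<psi>)
  have "sat M e \<psi> \<longleftrightarrow> sat M e' \<psi>"
    by (rule Neg.IH) (use Neg.prems in simp)
  then show ?case by simp
qed

lemma holds_map:
  assumes "free_vars \<phi> \<subseteq> set (xs @ ys)"
  shows "holds N \<phi> xs ys (map e xs) (map e ys) \<longleftrightarrow> sat N e \<phi>"
proof -
  have "the (map_of (zip (xs @ ys) (map e xs @ map e ys)) v) = e v" if "v \<in> free_vars \<phi>" for v
  proof -
    have "map_of (zip (xs @ ys) (map e (xs @ ys))) v = Some (e v)"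
      using that assms by (subst map_of_zip_map) auto
    then show ?thesis by simp
  qed
  then show ?thesis
    unfolding holds_def by (intro sat_cong) auto
qed

lemma sat_foldr_Exists:
  "sat N e (foldr Exists vs \<psi>) \<longleftrightarrow>
    (\<exists>e'. (\<forall>v. v \<notin> set vs \<longrightarrow> e' v = e v) \<and> e' ` set vs \<subseteq> univ N \<and> sat N e' \<psi>)"
proof (induction vs arbitrary: e)
  case Nil
  then show ?case
    by (simp flip: fun_eq_iff)
next
  case (Cons w vs)
  show ?case
  proof
    assume "sat N e (foldr Exists (w # vs) \<psi>)"
    then obtain c e' where "c \<in> univ N" "\<forall>v. v \<notin> set vs \<longrightarrow> e' v = (e(w := c)) v"
      "e' ` set vs \<subseteq> univ N" "sat N e' \<psi>"
      by (auto simp: Cons.IH)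
    then show "\<exists>e'. (\<forall>v. v \<notin> set (w # vs) \<longrightarrow> e' v = e v) \<and>
        e' ` set (w # vs) \<subseteq> univ N \<and> sat N e' \<psi>"
      by (intro exI[of _ e']) (cases "w \<in> set vs"; auto)
  next
    assume "\<exists>e'. (\<forall>v. v \<notin> set (w # vs) \<longrightarrow> e' v = e v) \<and>
        e' ` set (w # vs) \<subseteq> univ N \<and> sat N e' \<psi>"
    then obtain e' where e': "\<forall>v. v \<notin> set (w # vs) \<longrightarrow> e' v = e v"
      "e' ` set (w # vs) \<subseteq> univ N" "sat N e' \<psi>"
      by blast
    then have "sat N (e(w := e' w)) (foldr Exists vs \<psi>)"
      unfolding Cons.IH by (intro exI[of _ e']) auto
    then show "sat N e (foldr Exists (w # vs) \<psi>)"
      using e'(2) by auto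
  qed
qed

lemma sat_foldr_Conj:
  "sat N e (foldr Conj \<psi>s \<chi>) \<longleftrightarrow> (\<forall>\<psi>\<in>set \<psi>s. sat N e \<psi>) \<and> sat N e \<chi>"
  by (induction \<psi>s) auto

lemma free_vars_foldr_Exists: "free_vars (foldr Exists vs \<psi>) = free_vars \<psi> - set vs"
  by (induction vs) auto

lemma free_vars_foldr_Conj:
  "free_vars (foldr Conj \<psi>s \<chi>) = (\<Union>\<psi>\<in>set \<psi>s. free_vars \<psi>) \<union> free_vars \<chi>"
  by (induction \<psi>s) auto

lemma wf_form_foldr_Exists: "wf_form L (foldr Exists vs \<psi>) \<longleftrightarrow> wf_form L \<psi>"
  by (induction vs) auto

lemma wf_form_foldr_Conj:
  "wf_form L (foldr Conj \<psi>s \<chi>) \<longleftrightarrow> (\<forall>\<psi>\<in>set \<psi>s. wf_form L \<psi>) \<and> wf_form L \<chi>"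
  by (induction \<psi>s) auto

text \<open>The formula \<open>\<psi>(z,y)\<close>, where \<open>z\<close> is the \<open>i\<close>-th copy of the tuple \<open>x\<close>, obtained by shifting
  variable numbers by \<open>(i + 1) * K\<close>. It is written \<open>\<exists>x (x = z \<and> \<psi>(x,y))\<close>, which takes the place
  of a substitution and avoids renaming the bound variables of \<open>\<psi>\<close>. The factor is \<open>i + 1\<close> so that
  no copy overlaps the variables below \<open>K\<close>, among which \<open>x\<close> and \<open>y\<close> lie.\<close>

definition at_copy ::
  "nat \<Rightarrow> nat list \<Rightarrow> nat \<Rightarrow> ('f, 'r) fo_form \<Rightarrow> ('f, 'r) fo_form" where
  "at_copy K xs i \<psi> =
     foldr Exists xs (foldr Conj (map (\<lambda>v. Eq (Var v) (Var (v + Suc i * K))) xs) \<psi>)"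

text \<open>The formula \<open>\<exists>y \<And>\<^sub>i \<plusminus>\<phi>(z\<^sub>i,y)\<close>, where the \<open>z\<^sub>i\<close> are the copies of \<open>x\<close> and the signs are
  given by \<open>ss\<close>. The conjunction ends in a valid sentence, so that no variable outside the
  copies becomes free.\<close>

definition sign_pattern ::
  "nat \<Rightarrow> nat list \<Rightarrow> nat list \<Rightarrow> ('f, 'r) fo_form \<Rightarrow> bool list \<Rightarrow> ('f, 'r) fo_form" where
  "sign_pattern K xs ys \<phi> ss =
     foldr Exists ys
       (foldr Conj
         (map (\<lambda>i. at_copy K xs i (if ss ! i then \<phi> else Neg \<phi>)) [0..<length ss])
         (Neg (Exists 0 (Neg (Eq (Var 0) (Var 0))))))"

lemma wf_form_sign_pattern: "wf_form L \<phi> \<Longrightarrow> wf_form L (sign_pattern K xs ys \<phi> ss)"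
  by (auto simp: sign_pattern_def at_copy_def wf_form_foldr_Exists wf_form_foldr_Conj)

lemma free_vars_sign_pattern:
  assumes "free_vars \<phi> \<subseteq> set (xs @ ys)"
  shows "free_vars (sign_pattern K xs ys \<phi> ss) \<subseteq>
    {v + Suc i * K | v i. v \<in> set xs \<and> i < length ss}"
proof -
  have "free_vars (at_copy K xs i (if ss ! i then \<phi> else Neg \<phi>)) \<subseteq>
      set ys \<union> (\<lambda>v. v + Suc i * K) ` set xs" for i
    using assms unfolding at_copy_def free_vars_foldr_Exists free_vars_foldr_Conj
    by (auto simp del: mult_Suc)
  moreover have "free_vars (sign_pattern K xs ys \<phi> ss) =
      (\<Union>i<length ss. free_vars (at_copy K xs i (if ss ! i then \<phi> else Neg \<phi>))) - set ys"
    unfolding sign_pattern_def free_vars_foldr_Exists free_vars_foldr_Conj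
    by (simp add: atLeast0LessThan)
  ultimately show ?thesis
    by blast
qed

lemma sat_at_copy:
  assumes "set xs \<subseteq> {..<K}" "set xs \<inter> set ys = {}" "free_vars \<psi> \<subseteq> set (xs @ ys)"
    and a: "map (\<lambda>v. e (v + Suc i * K)) xs = a" "set a \<subseteq> univ N"
  shows "sat N e (at_copy K xs i \<psi>) \<longleftrightarrow> holds N \<psi> xs ys a (map e ys)"
proof -
  have fresh: "v + Suc i * K \<notin> set xs" for v
    using assms(1) by auto
  have "sat N e (at_copy K xs i \<psi>) \<longleftrightarrow>
      (\<exists>e'. (\<forall>v. v \<notin> set xs \<longrightarrow> e' v = e v) \<and> e' ` set xs \<subseteq> univ N \<and>
        (\<forall>v\<in>set xs. e' v = e' (v + Suc i * K)) \<and> sat N e' \<psi>)"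
    by (simp add: at_copy_def sat_foldr_Exists sat_foldr_Conj del: mult_Suc)
  also have "\<dots> \<longleftrightarrow>
      (\<exists>e'. (\<forall>v. v \<notin> set xs \<longrightarrow> e' v = e v) \<and> map e' xs = a \<and> sat N e' \<psi>)"
  proof -
    have "(e' ` set xs \<subseteq> univ N \<and> (\<forall>v\<in>set xs. e' v = e' (v + Suc i * K))) \<longleftrightarrow> map e' xs = a"
      if e': "\<forall>v. v \<notin> set xs \<longrightarrow> e' v = e v" for e'
    proof -
      have "(\<forall>v\<in>set xs. e' v = e' (v + Suc i * K)) \<longleftrightarrow> (\<forall>v\<in>set xs. e' v = e (v + Suc i * K))"
        using e' fresh by simp
      also have "\<dots> \<longleftrightarrow> map e' xs = a"
        unfolding a(1)[symmetric] map_eq_conv ..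
      finally show ?thesis
        using a(2) by auto
    qed
    then show ?thesis
      by (intro ex_cong1) blast
  qed
  also have "\<dots> \<longleftrightarrow> holds N \<psi> xs ys a (map e ys)"
  proof
    assume "\<exists>e'. (\<forall>v. v \<notin> set xs \<longrightarrow> e' v = e v) \<and> map e' xs = a \<and> sat N e' \<psi>"
    then obtain e' where e': "\<forall>v. v \<notin> set xs \<longrightarrow> e' v = e v" "map e' xs = a" "sat N e' \<psi>"
      by blast
    have ys: "map e' ys = map e ys"
      using e'(1) assms(2) by auto
    show "holds N \<psi> xs ys a (map e ys)"
      using e'(3) holds_map[OF assms(3), of N e'] unfolding ys e'(2) by blast
  next
    assume *: "holds N \<psi> xs ys a (map e ys)"
    define e' where "e' v = (if v \<in> set xs then e (v + Suc i * K) else e v)" for v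
    have xs: "map e' xs = a"
      unfolding a(1)[symmetric] by (simp add: e'_def)
    have ys: "map e' ys = map e ys"
      using assms(2) by (auto simp: e'_def)
    have "sat N e' \<psi>"
      using * holds_map[OF assms(3), of N e'] unfolding xs ys by blast
    moreover have "\<forall>v. v \<notin> set xs \<longrightarrow> e' v = e v"
      by (simp add: e'_def)
    ultimately show "\<exists>e'. (\<forall>v. v \<notin> set xs \<longrightarrow> e' v = e v) \<and> map e' xs = a \<and> sat N e' \<psi>"
      using xs by blast
  qed
  finally show ?thesis .
qed

lemma sat_sign_pattern:
  assumes K: "set (xs @ ys) \<subseteq> {..<K}" and "distinct (xs @ ys)"
    and "free_vars \<phi> \<subseteq> set (xs @ ys)"
    and "length ss = length as"
    and a: "\<And>i. i < length as \<Longrightarrow> map (\<lambda>v. e (v + Suc i * K)) xs = as ! i"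
      "\<And>i. i < length as \<Longrightarrow> set (as ! i) \<subseteq> univ N"
  shows "sat N e (sign_pattern K xs ys \<phi> ss) \<longleftrightarrow>
    (\<exists>b\<in>nlists (length ys) (univ N). \<forall>i<length as. holds N \<phi> xs ys (as ! i) b = ss ! i)"
proof -
  have fresh: "v + Suc i * K \<notin> set ys" for v i
    using K by auto
  have copy: "sat N e' (at_copy K xs i (if ss ! i then \<phi> else Neg \<phi>)) \<longleftrightarrow>
      holds N \<phi> xs ys (as ! i) (map e' ys) = ss ! i"
    if "\<forall>v. v \<notin> set ys \<longrightarrow> e' v = e v" "i < length as" for e' i
  proof -
    have "map (\<lambda>v. e' (v + Suc i * K)) xs = as ! i"
      using a(1)[OF that(2)] that(1) fresh by (simp del: mult_Suc)
    then have "sat N e' (at_copy K xs i \<psi>) \<longleftrightarrow> holds N \<psi> xs ys (as ! i) (map e' ys)"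
      if "free_vars \<psi> \<subseteq> set (xs @ ys)" for \<psi> :: "('a, 'b) fo_form"
      using sat_at_copy[of xs K ys \<psi> e' i "as ! i" N] K \<open>distinct (xs @ ys)\<close> that
        a(2)[OF \<open>i < length as\<close>] by auto
    then show ?thesis
      using assms(3) by (auto simp: holds_def)
  qed
  have "sat N e (sign_pattern K xs ys \<phi> ss) \<longleftrightarrow>
    (\<exists>e'. (\<forall>v. v \<notin> set ys \<longrightarrow> e' v = e v) \<and> e' ` set ys \<subseteq> univ N \<and>
      (\<forall>i<length as. sat N e' (at_copy K xs i (if ss ! i then \<phi> else Neg \<phi>))))"
  proof -
    have "(\<forall>i\<in>{0..<length as}. Q i) \<longleftrightarrow> (\<forall>i<length as. Q i)" for Q
      by auto
    then show ?thesis
      unfolding sign_pattern_def sat_foldr_Exists sat_foldr_Conj set_map ball_simps set_upt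
        \<open>length ss = length as\<close>
      by simp
  qed
  also have "\<dots> \<longleftrightarrow>
    (\<exists>e'. (\<forall>v. v \<notin> set ys \<longrightarrow> e' v = e v) \<and> e' ` set ys \<subseteq> univ N \<and>
      (\<forall>i<length as. holds N \<phi> xs ys (as ! i) (map e' ys) = ss ! i))"
    using copy by (intro ex_cong1) blast
  also have "\<dots> \<longleftrightarrow>
    (\<exists>b\<in>nlists (length ys) (univ N). \<forall>i<length as. holds N \<phi> xs ys (as ! i) b = ss ! i)"
  proof
    assume "\<exists>e'. (\<forall>v. v \<notin> set ys \<longrightarrow> e' v = e v) \<and> e' ` set ys \<subseteq> univ N \<and>
      (\<forall>i<length as. holds N \<phi> xs ys (as ! i) (map e' ys) = ss ! i)"
    then obtain e' where "e' ` set ys \<subseteq> univ N"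
      "\<forall>i<length as. holds N \<phi> xs ys (as ! i) (map e' ys) = ss ! i"
      by blast
    then show "\<exists>b\<in>nlists (length ys) (univ N).
        \<forall>i<length as. holds N \<phi> xs ys (as ! i) b = ss ! i"
      by (intro bexI[of _ "map e' ys"]) simp_all
  next
    assume "\<exists>b\<in>nlists (length ys) (univ N).
        \<forall>i<length as. holds N \<phi> xs ys (as ! i) b = ss ! i"
    then obtain b where "b \<in> nlists (length ys) (univ N)"
      and signs: "\<forall>i<length as. holds N \<phi> xs ys (as ! i) b = ss ! i"
      by blast
    then have b: "length b = length ys" "set b \<subseteq> univ N"
      by simp_all
    define e' where "e' v = (case map_of (zip ys b) v of None \<Rightarrow> e v | Some c \<Rightarrow> c)" for v
    have "map e' ys = b"
      using b(1) \<open>distinct (xs @ ys)\<close>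
      by (intro nth_equalityI) (auto simp: e'_def map_of_zip_nth)
    moreover have "\<forall>v. v \<notin> set ys \<longrightarrow> e' v = e v"
      using b(1) by (auto simp: e'_def split: option.splits dest: map_of_SomeD set_zip_leftD)
    moreover have "e' ` set ys \<subseteq> univ N"
      using b(2) unfolding \<open>map e' ys = b\<close>[symmetric] by simp
    ultimately show "\<exists>e'. (\<forall>v. v \<notin> set ys \<longrightarrow> e' v = e v) \<and> e' ` set ys \<subseteq> univ N \<and>
      (\<forall>i<length as. holds N \<phi> xs ys (as ! i) (map e' ys) = ss ! i)"
      using signs by blast
  qed
  finally show ?thesis .
qed

text \<open>Realisability of a finite sign pattern over tuples from \<open>M\<close> is a first-order property of these
  tuples, so it passes from an elementary extension down to \<open>M\<close>.\<close>

lemma sign_pattern_descends: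
  assumes \<phi>: "is_formula_in L \<phi> xs ys" and ext: "elementary_extension L M N"
    and as: "\<And>i. i < length as \<Longrightarrow> as ! i \<in> nlists (length xs) (univ M)"
    and len: "length ss = length as"
    and N: "\<exists>b\<in>nlists (length ys) (univ N). \<forall>i<length as. holds N \<phi> xs ys (as ! i) b = ss ! i"
  shows "\<exists>b\<in>nlists (length ys) (univ M). \<forall>i<length as. holds M \<phi> xs ys (as ! i) b = ss ! i"
proof -
  obtain K where K: "set (xs @ ys) \<subseteq> {..<K}"
    using finite_nat_bounded[of "set (xs @ ys)"] by auto
  have \<phi>': "wf_form L \<phi>" "distinct (xs @ ys)" "free_vars \<phi> \<subseteq> set (xs @ ys)"
    using \<phi> by (auto simp: is_formula_in_def)
  have MN: "univ M \<subseteq> univ N"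
    using ext by (simp add: elementary_extension_def substructure_def)
  \<comment> \<open>Division and remainder by \<open>K\<close> recover from a variable the number of its copy and the
    variable of \<open>x\<close> that it copies.\<close>
  define e where "e w = the (map_of (zip xs (as ! (w div K - 1))) (w mod K))" for w
  have e: "map (\<lambda>v. e (v + Suc i * K)) xs = as ! i" if i: "i < length as" for i
  proof (rule nth_equalityI)
    fix k assume k: "k < length (map (\<lambda>v. e (v + Suc i * K)) xs)"
    then have "xs ! k \<in> set (xs @ ys)"
      by simp
    then have v: "xs ! k < K"
      using K by blast
    have "(xs ! k + Suc i * K) div K = Suc i" "(xs ! k + Suc i * K) mod K = xs ! k"
      using v by (simp_all add: div_mult_self1 del: mult_Suc)
    then show "map (\<lambda>v. e (v + Suc i * K)) xs ! k = as ! i ! k"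
      using k as[OF i] \<phi>'(2) by (simp add: e_def map_of_zip_nth del: mult_Suc)
  qed (use as[OF i] in simp)
  have as_sub: "set (as ! i) \<subseteq> univ M" if "i < length as" for i
    using as[OF that] by simp
  have "e ` free_vars (sign_pattern K xs ys \<phi> ss) \<subseteq> univ M"
  proof
    fix c assume "c \<in> e ` free_vars (sign_pattern K xs ys \<phi> ss)"
    then obtain v i where "v \<in> set xs" "i < length as" "c = e (v + Suc i * K)"
      using free_vars_sign_pattern[OF \<phi>'(3), of K ss] len by auto
    then have "c \<in> set (as ! i)"
      using e[of i] by (metis (no_types, lifting) image_eqI list.set_map)
    then show "c \<in> univ M"
      using as_sub \<open>i < length as\<close> by blast
  qed
  then have "sat M e (sign_pattern K xs ys \<phi> ss) \<longleftrightarrow> sat N e (sign_pattern K xs ys \<phi> ss)"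
    using ext wf_form_sign_pattern[OF \<phi>'(1)] by (simp add: elementary_extension_def)
  then show ?thesis
    using N sat_sign_pattern[OF K \<phi>'(2,3) len e, of N]
      sat_sign_pattern[OF K \<phi>'(2,3) len e, of M] as_sub MN by (meson subset_trans)
qed

text \<open>The property IP quantifies over all finite patterns, one at a time, and each of them descends.\<close>

lemma IP_in_descends:
  assumes \<phi>: "is_formula_in L \<phi> xs ys" and ext: "elementary_extension L M N"
    and A: "A \<subseteq> nlists (length xs) (univ M)" and IP: "IP_in N \<phi> xs ys A"
  shows "IP_in M \<phi> xs ys A"
proof -
  obtain a :: "nat \<Rightarrow> 'c list" where a: "range a \<subseteq> A" "IP_witness N \<phi> xs ys UNIV a"
    using IP by (auto simp: IP_in_def)
  have "\<exists>b\<in>nlists (length ys) (univ M).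
      (\<forall>\<alpha>\<in>I. holds M \<phi> xs ys (a \<alpha>) b) \<and> (\<forall>\<beta>\<in>J. \<not> holds M \<phi> xs ys (a \<beta>) b)"
    if IJ: "finite I" "finite J" "I \<inter> J = {}" for I J
  proof -
    obtain ks where ks: "set ks = I \<union> J"
      using IJ finite_list[of "I \<union> J"] by auto
    have signs: "(\<forall>i<length ks. holds Q \<phi> xs ys (map a ks ! i) b = map (\<lambda>k. k \<in> I) ks ! i) \<longleftrightarrow>
      (\<forall>\<alpha>\<in>I. holds Q \<phi> xs ys (a \<alpha>) b) \<and> (\<forall>\<beta>\<in>J. \<not> holds Q \<phi> xs ys (a \<beta>) b)" for Q b
    proof -
      have "(\<forall>i<length ks. holds Q \<phi> xs ys (map a ks ! i) b = map (\<lambda>k. k \<in> I) ks ! i) \<longleftrightarrow>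
          (\<forall>k\<in>set ks. holds Q \<phi> xs ys (a k) b \<longleftrightarrow> k \<in> I)"
        by (auto simp: all_set_conv_all_nth)
      then show ?thesis
        using ks IJ(3) by auto
    qed
    have "\<exists>b\<in>nlists (length ys) (univ N).
        (\<forall>\<alpha>\<in>I. holds N \<phi> xs ys (a \<alpha>) b) \<and> (\<forall>\<beta>\<in>J. \<not> holds N \<phi> xs ys (a \<beta>) b)"
      using a(2) IJ by (auto simp: IP_witness_def)
    then show ?thesis
      using sign_pattern_descends[OF \<phi> ext, of "map a ks" "map (\<lambda>k. k \<in> I) ks"] a(1) A
      by (simp only: signs length_map) auto
  qed
  then have "IP_witness M \<phi> xs ys UNIV a"
    by (simp add: IP_witness_def)
  then show ?thesis
    using a(1) by (auto simp: IP_in_def)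
qed

section \<open>Types finitely satisfiable in a set\<close>

text \<open>Types are counted through their traces: the sets \<open>\<phi>(x,b)\<close> generate the algebra, so a
  \<open>\<phi>\<close>-type is determined by its trace, and a trace is merely a set of parameters.\<close>

definition type_trace ::
  "('f, 'r, 'm) fo_struct \<Rightarrow> ('f, 'r) fo_form \<Rightarrow> nat list \<Rightarrow> nat list \<Rightarrow> 'm list set set \<Rightarrow> 'm list set"
where
  "type_trace N \<phi> xs ys p = {b \<in> nlists (length ys) (univ N). phi_set N \<phi> xs ys b \<in> p}"

lemma algebra_phi_algebra: "algebra (nlists (length xs) (univ N)) (phi_algebra N \<phi> xs ys)"
  (is "algebra ?\<Omega> _")
proof -
  let ?gens = "phi_set N \<phi> xs ys ` nlists (length ys) (univ N)"
  have "?gens \<subseteq> Pow ?\<Omega>"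
    by (auto simp: phi_set_def)
  then have "phi_algebra N \<phi> xs ys \<subseteq> Pow ?\<Omega>"
    unfolding phi_algebra_def by (rule hull_minimal) (auto simp: algebra_iff_Un)
  then show ?thesis
    unfolding algebra_iff_Un phi_algebra_def hull_def by (auto simp: algebra_iff_Un)
qed

lemma phi_set_in_phi_algebra:
  "b \<in> nlists (length ys) (univ N) \<Longrightarrow> phi_set N \<phi> xs ys b \<in> phi_algebra N \<phi> xs ys"
  unfolding phi_algebra_def by (intro hull_inc imageI)

lemma ultrafilter_on_compl_iff:
  assumes "ultrafilter_on \<Omega> \<B> U" "S \<in> \<B>"
  shows "\<Omega> - S \<in> U \<longleftrightarrow> S \<notin> U"
proof -
  have "\<not> (S \<in> U \<and> \<Omega> - S \<in> U)"
    using assms(1) unfolding ultrafilter_on_def by (metis Diff_disjoint)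
  then show ?thesis
    using assms unfolding ultrafilter_on_def by blast
qed

lemma ultrafilter_on_Int_iff:
  assumes "ultrafilter_on \<Omega> \<B> U" "S \<in> \<B>" "T \<in> \<B>"
  shows "S \<inter> T \<in> U \<longleftrightarrow> S \<in> U \<and> T \<in> U"
  using assms unfolding ultrafilter_on_def by (metis Int_lower1 Int_lower2)

lemma ultrafilter_on_Inter:
  assumes "ultrafilter_on \<Omega> \<B> U" "finite \<S>" "\<S> \<subseteq> U"
  shows "\<Omega> \<inter> \<Inter>\<S> \<in> U"
  using assms(2,3)
proof (induction \<S>)
  case empty
  then show ?case
    using assms(1) by (simp add: ultrafilter_on_def)
next
  case (insert S \<S>)
  then have "S \<inter> (\<Omega> \<inter> \<Inter>\<S>) \<in> U"
    using assms(1) by (simp add: ultrafilter_on_def)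
  then show ?case
    by (simp add: Int_left_commute)
qed

lemma inj_on_type_trace: "inj_on (type_trace N \<phi> xs ys) (phi_types N \<phi> xs ys)"
proof (rule inj_onI)
  let ?\<Omega> = "nlists (length xs) (univ N)" and ?\<B> = "phi_algebra N \<phi> xs ys"
  fix p q
  assume pq: "p \<in> phi_types N \<phi> xs ys" "q \<in> phi_types N \<phi> xs ys"
    and eq: "type_trace N \<phi> xs ys p = type_trace N \<phi> xs ys q"
  have p: "ultrafilter_on ?\<Omega> ?\<B> p" and q: "ultrafilter_on ?\<Omega> ?\<B> q"
    using pq by (simp_all add: phi_types_def)
  interpret \<B>: algebra ?\<Omega> ?\<B>
    by (rule algebra_phi_algebra)
  have "{} \<in> ?\<B>" "{} \<notin> p" "{} \<notin> q"
    using p q by (auto simp: ultrafilter_on_def)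
  then have "algebra ?\<Omega> {S \<in> ?\<B>. S \<in> p \<longleftrightarrow> S \<in> q}"
    unfolding algebra_iff_Int using \<B>.space_closed
    by (auto simp: ultrafilter_on_compl_iff[OF p] ultrafilter_on_compl_iff[OF q]
        ultrafilter_on_Int_iff[OF p] ultrafilter_on_Int_iff[OF q])
  moreover have "phi_set N \<phi> xs ys ` nlists (length ys) (univ N) \<subseteq> {S \<in> ?\<B>. S \<in> p \<longleftrightarrow> S \<in> q}"
    using eq by (auto simp: phi_set_in_phi_algebra type_trace_def)
  ultimately have "?\<B> \<subseteq> {S \<in> ?\<B>. S \<in> p \<longleftrightarrow> S \<in> q}"
    by (subst (1) phi_algebra_def) (rule hull_minimal)
  moreover have "p \<subseteq> ?\<B>" "q \<subseteq> ?\<B>"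
    using p q by (simp_all add: ultrafilter_on_def)
  ultimately show "p = q"
    by blast
qed

text \<open>The finitely many instances of \<open>\<phi>\<close> and \<open>\<not>\<phi>\<close> chosen by \<open>p\<close> at the parameters in \<open>P\<close> and \<open>Q\<close>
  have their intersection in \<open>p\<close>, hence a common solution in \<open>A\<close>. Thus the trace of \<open>p\<close> is a
  pointwise limit of the sets that the members of \<open>A\<close> define on the parameters.\<close>

lemma finitely_satisfiable_separates:
  assumes p: "p \<in> phi_types N \<phi> xs ys" and fs: "finitely_satisfiable_in p A"
    and fin: "finite P" "finite Q"
    and P: "P \<subseteq> type_trace N \<phi> xs ys p"
    and Q: "Q \<subseteq> nlists (length ys) (univ N) - type_trace N \<phi> xs ys p"
  shows "\<exists>a\<in>A. (\<forall>b\<in>P. holds N \<phi> xs ys a b) \<and> (\<forall>b\<in>Q. \<not> holds N \<phi> xs ys a b)"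
proof -
  let ?\<Omega> = "nlists (length xs) (univ N)"
  let ?\<S> = "phi_set N \<phi> xs ys ` P \<union> (\<lambda>b. ?\<Omega> - phi_set N \<phi> xs ys b) ` Q"
  have uf: "ultrafilter_on ?\<Omega> (phi_algebra N \<phi> xs ys) p"
    using p by (simp add: phi_types_def)
  have "?\<S> \<subseteq> p"
    using P Q phi_set_in_phi_algebra[of _ ys N \<phi> xs]
    by (auto simp: type_trace_def ultrafilter_on_compl_iff[OF uf])
  then have "?\<Omega> \<inter> \<Inter>?\<S> \<in> p"
    using fin by (intro ultrafilter_on_Inter[OF uf]) auto
  then obtain a where "a \<in> A" "a \<in> ?\<Omega> \<inter> \<Inter>?\<S>"
    using fs unfolding finitely_satisfiable_in_def by blast
  then have "a \<in> ?\<Omega>" "\<And>b. b \<in> P \<Longrightarrow> a \<in> phi_set N \<phi> xs ys b" "\<And>b. b \<in> Q \<Longrightarrow> a \<notin> phi_set N \<phi> xs ys b"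
    by blast+
  with \<open>a \<in> A\<close> show ?thesis
    by (intro bexI[of _ a]) (simp_all add: phi_set_def)
qed

text \<open>Otherwise the trace would split every sign cell that meets \<open>C\<close>, and being a pointwise limit of
  the sets defined by members of \<open>A\<close> it would produce an independent sequence in \<open>A\<close>.\<close>

lemma type_trace_piecewise_constant:
  assumes nip: "NIP_in N \<phi> xs ys A"
    and p: "p \<in> phi_types N \<phi> xs ys" "finitely_satisfiable_in p A"
    and C: "C \<subseteq> nlists (length ys) (univ N)" "C \<noteq> {}"
  shows "\<exists>i\<in>Fpow A \<times> Fpow A. sign_cell (holds N \<phi> xs ys) i \<inter> C \<noteq> {} \<and>
    (sign_cell (holds N \<phi> xs ys) i \<inter> C \<subseteq> type_trace N \<phi> xs ys p \<or>
     sign_cell (holds N \<phi> xs ys) i \<inter> C \<inter> type_trace N \<phi> xs ys p = {})"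
proof (rule ccontr)
  assume neg: "\<not> ?thesis"
  have "\<exists>s :: nat \<Rightarrow> 'c list. range s \<subseteq> A \<and>
    (\<forall>I J. finite I \<and> finite J \<and> I \<inter> J = {} \<longrightarrow>
       (\<exists>y\<in>C. (\<forall>i\<in>I. holds N \<phi> xs ys (s i) y) \<and> (\<forall>j\<in>J. \<not> holds N \<phi> xs ys (s j) y)))"
  proof (rule independent_sequence_exists[OF C(2), where D = "type_trace N \<phi> xs ys p"])
    fix P Q
    assume "finite P" "finite Q" "P \<subseteq> C \<inter> type_trace N \<phi> xs ys p" "Q \<subseteq> C - type_trace N \<phi> xs ys p"
    then show "\<exists>a\<in>A. (\<forall>y\<in>P. holds N \<phi> xs ys a y) \<and> (\<forall>y\<in>Q. \<not> holds N \<phi> xs ys a y)"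
      using C(1) by (intro finitely_satisfiable_separates[OF p]) auto
  qed (use neg in blast)
  then have "IP_in N \<phi> xs ys A"
    using C(1) unfolding IP_in_def IP_witness_def by (metis (no_types, opaque_lifting) subsetD)
  then show False
    using nip by (simp add: NIP_in_def)
qed

text \<open>The traces are piecewise constant with respect to sign cells, and the cells are indexed by pairs
  of finite subsets of \<open>A\<close>, of which there are \<open>|A|\<close> many.\<close>

lemma card_of_types_finitely_satisfiable_infinite:
  assumes "NIP_in N \<phi> xs ys A" and inf: "infinite A"
  shows "|{p \<in> phi_types N \<phi> xs ys. finitely_satisfiable_in p A}| \<le>o |Pow A|"
proof -
  let ?T = "{p \<in> phi_types N \<phi> xs ys. finitely_satisfiable_in p A}"
  let ?I = "Fpow A \<times> Fpow A"
  have F: "|Fpow A| =o |A|"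
    by (rule card_of_Fpow_infinite[OF inf])
  then have Finf: "infinite (Fpow A)"
    using inf card_of_ordIso_finite by blast
  have I: "|?I| =o |A|"
    using card_of_Times_same_infinite[OF Finf] F by (rule ordIso_transitive)
  have "infinite ?I"
    using I inf card_of_ordIso_finite by blast
  then have "|type_trace N \<phi> xs ys ` ?T| \<le>o |Pow ?I|"
  proof (rule card_of_piecewise_constant_sets
      [where Y = "nlists (length ys) (univ N)" and U = "sign_cell (holds N \<phi> xs ys)"])
    fix D C
    assume "D \<in> type_trace N \<phi> xs ys ` ?T" "C \<subseteq> nlists (length ys) (univ N)" "C \<noteq> {}"
    then show "\<exists>i\<in>?I. sign_cell (holds N \<phi> xs ys) i \<inter> C \<noteq> {} \<and>
        (sign_cell (holds N \<phi> xs ys) i \<inter> C \<subseteq> D \<or> sign_cell (holds N \<phi> xs ys) i \<inter> C \<inter> D = {})"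
      using type_trace_piecewise_constant[OF assms(1)] by blast
  qed (auto simp: type_trace_def)
  moreover have "|?T| \<le>o |type_trace N \<phi> xs ys ` ?T|"
    using inj_on_subset[OF inj_on_type_trace, of ?T N \<phi> xs ys]
    by (intro card_of_ordLeqI) auto
  moreover have "|Pow ?I| \<le>o |Pow A|"
    using I by (simp add: ordIso_iff_ordLeq)
  ultimately show ?thesis
    by (blast intro: ordLeq_transitive)
qed

text \<open>The sets in \<open>p\<close> have a common element in the finite set \<open>A\<close>: if each \<open>a \<in> A\<close> were missed by
  some set in \<open>p\<close>, the finite intersection of these sets would miss \<open>A\<close>. So \<open>p\<close> is the type of
  an element of \<open>A\<close>.\<close>

lemma card_of_types_finitely_satisfiable_finite:
  assumes "finite A"
  shows "|{p \<in> phi_types N \<phi> xs ys. finitely_satisfiable_in p A}| \<le>o |A|"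
proof -
  let ?T = "{p \<in> phi_types N \<phi> xs ys. finitely_satisfiable_in p A}"
  let ?\<Omega> = "nlists (length xs) (univ N)" and ?\<B> = "phi_algebra N \<phi> xs ys"
  have "?T \<subseteq> (\<lambda>a. {S \<in> ?\<B>. a \<in> S}) ` A"
  proof
    fix p assume p: "p \<in> ?T"
    then have uf: "ultrafilter_on ?\<Omega> ?\<B> p"
      by (simp add: phi_types_def)
    have "\<exists>a\<in>A. \<forall>S\<in>p. a \<in> S"
    proof (rule ccontr)
      assume "\<not> (\<exists>a\<in>A. \<forall>S\<in>p. a \<in> S)"
      then have "\<forall>a\<in>A. \<exists>S. S \<in> p \<and> a \<notin> S"
        by blast
      then obtain S where S: "\<forall>a\<in>A. S a \<in> p \<and> a \<notin> S a"
        by (rule bchoice[THEN exE])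
      have "?\<Omega> \<inter> \<Inter>(S ` A) \<in> p"
        using S assms by (intro ultrafilter_on_Inter[OF uf]) auto
      moreover have "\<forall>S\<in>p. \<exists>a\<in>A. a \<in> S"
        using p by (simp add: finitely_satisfiable_in_def)
      ultimately have "\<exists>a\<in>A. a \<in> ?\<Omega> \<inter> \<Inter>(S ` A)"
        by (rule bspec[rotated])
      then obtain a where "a \<in> A" "a \<in> ?\<Omega> \<inter> \<Inter>(S ` A)"
        by blast
      then show False
        using S by blast
    qed
    then obtain a where a: "a \<in> A" "\<And>S. S \<in> p \<Longrightarrow> a \<in> S"
      by blast
    have "S \<in> p" if "S \<in> ?\<B>" "a \<in> S" for S
      using a(2)[of "?\<Omega> - S"] ultrafilter_on_compl_iff[OF uf that(1)] that(2) by blast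
    moreover have "p \<subseteq> ?\<B>"
      using uf by (simp add: ultrafilter_on_def)
    ultimately have "p = {S \<in> ?\<B>. a \<in> S}"
      using a(2) by blast
    then show "p \<in> (\<lambda>a. {S \<in> ?\<B>. a \<in> S}) ` A"
      using a(1) by blast
  qed
  then show ?thesis
    by (rule surj_imp_ordLeq)
qed

section \<open>The number of finitely satisfiable types\<close>

theorem proposition2p3:
  fixes L :: "('f, 'r) lang"
    and \<phi> :: "('f, 'r) fo_form"
    and xs ys :: "nat list"
    and M Mstar :: "('f, 'r, 'm) fo_struct"
    and A :: "'m list set"
    and \<kappa> :: "'k rel"
  assumes "is_formula_in L \<phi> xs ys"
    and "is_struct L M"
    and "A \<subseteq> nlists (length xs) (univ M)"
    and "elementary_extension L M Mstar"
    and "saturated L (cardSuc |univ M| ) Mstar"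
    and "NIP_in M \<phi> xs ys A"
    and "Card_order \<kappa>"
    and "|A| \<le>o \<kappa>"
  shows "|{p \<in> phi_types Mstar \<phi> xs ys. finitely_satisfiable_in p A}| \<le>o ctwo ^c \<kappa>"
proof (cases "finite A")
  case True
  have "\<kappa> \<le>o ctwo ^c \<kappa>"
    by (intro ordLess_imp_ordLeq ordLess_ctwo_cexp assms)
  then show ?thesis
    using card_of_types_finitely_satisfiable_finite[OF True] \<open>|A| \<le>o \<kappa>\<close>
    by (blast intro: ordLeq_transitive)
next
  case False
  have "NIP_in Mstar \<phi> xs ys A"
    using IP_in_descends[OF assms(1,4,3)] assms(6) unfolding NIP_in_def by blast
  then have "|{p \<in> phi_types Mstar \<phi> xs ys. finitely_satisfiable_in p A}| \<le>o |Pow A|"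
    using False by (rule card_of_types_finitely_satisfiable_infinite)
  also have "|Pow A| =o ctwo ^c |A|"
    by (rule Pow_cexp_ctwo)
  also have "ctwo ^c |A| \<le>o ctwo ^c \<kappa>"
    using False by (intro cexp_mono2_Cnotzero assms(8) Card_order_ctwo)
      (auto simp: Cinfinite_Cnotzero cinfinite_def)
  finally show ?thesis .
qed

end
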